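(* Let $G$ be a finite group. Then the co-prime graph $\Gamma(G)$ is a cograph if and only if there do not exist pairwise distinct primes $p_1,p_2,p_3$ and elements $g_1,g_2\in G$ with $o(g_1)=p_1p_2$ and $o(g_2)=p_2p_3$.
   Context: For a finite group $G$, the co-prime graph $\Gamma(G)$ is the simple undirected graph with vertex set $G$ (including the identity) in which two distinct vertices $x,y$ are adjacent if and only if $\gcd(o(x),o(y))=1$, where $o(g)$ denotes the order of $g$. A graph is a cograph if it contains no induced subgraph isomorphic to $P_4$, the path on 4 vertices. *)

theory Defs
  imports
    "HOL-Algebra.Multiplicative_Group"
    "HOL-Computational_Algebra.Primes"
    "Graph_Theory.Pair_Digraph"
    "Graph_Theory.Digraph_Isomorphism"
begin

text \<open>
  As in \<^theory>\<open>Graph_Theory.Pair_Digraph\<close>, a finite simple undirected graph is a finite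
  loop-free symmetric digraph without parallel arcs (locale \<^locale>\<open>pair_graph\<close>): the
  edge \<open>{x, y}\<close> is represented by the two arcs \<open>(x, y)\<close> and \<open>(y, x)\<close>.
\<close>

definition coprime_graph :: "('a, 'b) monoid_scheme \<Rightarrow> 'a pair_pre_digraph" where
  "coprime_graph G =
    \<lparr> pverts = carrier G,
      parcs = {(x, y). x \<in> carrier G \<and> y \<in> carrier G \<and> x \<noteq> y \<and>
                       gcd (group.ord G x) (group.ord G y) = 1} \<rparr>"

definition path_P4 :: "nat pair_pre_digraph" where
  "path_P4 =
    \<lparr> pverts = {0, 1, 2, 3},
      parcs = {(0, 1), (1, 0), (1, 2), (2, 1), (2, 3), (3, 2)} \<rparr>"

text \<open>
  The predicate is meant for arguments satisfying \<^locale>\<open>pair_graph\<close>; note that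
  \<^const>\<open>induced_subgraph\<close> is false for ill-formed digraphs.
\<close>

definition cograph :: "'a pair_pre_digraph \<Rightarrow> bool" where
  "cograph G \<longleftrightarrow>
    \<not> (\<exists>H :: 'a pair_pre_digraph. induced_subgraph (with_proj H) (with_proj G) \<and>
          digraph_iso (with_proj H) (with_proj path_P4))"

lemma pair_graph_coprime_graph:
  assumes "finite (carrier G)"
  shows "pair_graph (coprime_graph G)"
proof
  show "finite (parcs (coprime_graph G))"
    by (rule finite_subset[of _ "carrier G \<times> carrier G"])
      (use assms in \<open>auto simp: coprime_graph_def\<close>)
qed (use assms in \<open>auto simp: coprime_graph_def symmetric_def gcd.commute intro!: symI\<close>)

lemma pair_graph_path_P4: "pair_graph path_P4"
  by unfold_locales (auto simp: path_P4_def symmetric_def intro!: symI)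

end

theory Submission
  imports Defs
begin

text \<open>
  An induced path \<open>a - b - c - d\<close> in the co-prime graph is governed by its three non-edges
  \<open>{a, c}\<close>, \<open>{a, d}\<close> and \<open>{b, d}\<close>: each supplies a prime dividing the orders of both of its
  ends, and these primes \<open>p1\<close>, \<open>p2\<close>, \<open>p3\<close> are distinct because two equal ones would divide
  the orders of both ends of the edge \<open>{a, b}\<close> or of the edge \<open>{c, d}\<close>. The end
  \<open>a\<close> lies on the first two non-edges and the end \<open>d\<close> on the last two, so \<open>p1 * p2\<close> divides
  the order of \<open>a\<close> and \<open>p2 * p3\<close> divides that of \<open>d\<close>; suitable powers of \<open>a\<close> and \<open>d\<close> have
  exactly these orders.

  Conversely, if \<open>g1\<close> and \<open>g2\<close> have orders \<open>p1 * p2\<close> and \<open>p2 * p3\<close>, then the powers of \<open>g2\<close>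
  and \<open>g1\<close> of orders \<open>p3\<close> and \<open>p1\<close> can serve as the inner vertices \<open>b\<close> and \<open>c\<close> between the
  ends \<open>g1\<close> and \<open>g2\<close>.

  The graph-theoretic part, \<open>not_cograph_iff_induced_path\<close>, replaces the isomorphic copy of
  the four-vertex path by four named vertices.
\<close>

section \<open>Induced copies of pair digraphs\<close>

text \<open>
  An isomorphism in the sense of \<^const>\<open>digraph_iso\<close> carries a separate map on arcs. For
  digraphs whose arcs are pairs of vertices that map is determined by the map on vertices.
\<close>

lemma pair_digraph_iso_iff:
  assumes H: "pair_wf_digraph H" and K: "pair_wf_digraph K"
  shows "digraph_iso (with_proj H) (with_proj K) \<longleftrightarrow>
    (\<exists>f. bij_betw f (pverts H) (pverts K) \<and>
         (\<forall>u \<in> pverts H. \<forall>v \<in> pverts H. (u, v) \<in> parcs H \<longleftrightarrow> (f u, f v) \<in> parcs K))"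
    (is "?iso \<longleftrightarrow> ?bij")
proof
  interpret H: pair_wf_digraph H by (rule H)
  assume ?iso
  then obtain h where h: "H.digraph_isomorphism h"
    and K_eq: "with_proj K = app_iso h (with_proj H)"
    unfolding digraph_iso_def by blast
  have pverts_K: "pverts K = iso_verts h ` pverts H"
    using arg_cong[OF K_eq, of verts] by simp
  have parcs_K: "parcs K = iso_arcs h ` parcs H"
    using arg_cong[OF K_eq, of arcs] by simp
  have tail_h: "iso_tail h = fst" and head_h: "iso_head h = snd"
    using arg_cong[OF K_eq, of tail] arg_cong[OF K_eq, of head] by simp_all
  have inj: "inj_on (iso_verts h) (pverts H)"
    using h by (simp add: pre_digraph.digraph_isomorphism_def)
  have arc_image: "iso_arcs h e = (iso_verts h (fst e), iso_verts h (snd e))"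
    if "e \<in> parcs H" for e
    using h that by (simp add: pre_digraph.digraph_isomorphism_def tail_h head_h prod_eq_iff)
  have "(u, v) \<in> parcs H \<longleftrightarrow> (iso_verts h u, iso_verts h v) \<in> parcs K"
    if uv: "u \<in> pverts H" "v \<in> pverts H" for u v
  proof
    assume "(u, v) \<in> parcs H"
    then show "(iso_verts h u, iso_verts h v) \<in> parcs K"
      using arc_image parcs_K by force
  next
    assume "(iso_verts h u, iso_verts h v) \<in> parcs K"
    then obtain e where e: "e \<in> parcs H" "iso_arcs h e = (iso_verts h u, iso_verts h v)"
      unfolding parcs_K by force
    then have "fst e = u" "snd e = v"
      using arc_image inj_onD[OF inj] uv H.arc_fst_in_verts H.arc_snd_in_verts by auto
    then show "(u, v) \<in> parcs H"
      using e(1) by auto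
  qed
  then show ?bij
    using inj pverts_K by (auto simp: bij_betw_def)
next
  interpret H: pair_wf_digraph H by (rule H)
  interpret K: pair_wf_digraph K by (rule K)
  assume ?bij
  then obtain f where bij: "bij_betw f (pverts H) (pverts K)"
    and arcs: "\<And>u v. u \<in> pverts H \<Longrightarrow> v \<in> pverts H \<Longrightarrow> (u, v) \<in> parcs H \<longleftrightarrow> (f u, f v) \<in> parcs K"
    by blast
  have inj: "inj_on f (pverts H)" and img: "f ` pverts H = pverts K"
    using bij by (auto simp: bij_betw_def)
  define h where
    "h = \<lparr>iso_verts = f, iso_arcs = map_prod f f, iso_head = snd, iso_tail = fst\<rparr>"
  have "inj_on (map_prod f f) (parcs H)"
    using inj H.in_arcsD1 H.in_arcsD2 by (intro map_prod_inj_on[THEN inj_on_subset]) auto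
  then have "H.digraph_isomorphism h"
    using inj H.wf_digraph_axioms by (auto simp: pre_digraph.digraph_isomorphism_def h_def)
  moreover have "map_prod f f ` parcs H = parcs K"
  proof (intro equalityI subsetI)
    fix e assume "e \<in> map_prod f f ` parcs H"
    then show "e \<in> parcs K"
      using arcs by (auto dest: H.in_arcsD1 H.in_arcsD2)
  next
    fix e assume e: "e \<in> parcs K"
    then have "fst e \<in> f ` pverts H" "snd e \<in> f ` pverts H"
      unfolding img by (rule K.arc_fst_in_verts K.arc_snd_in_verts)+
    then obtain u v where "u \<in> pverts H" "v \<in> pverts H" "e = (f u, f v)"
      by (auto simp: prod_eq_iff)
    with e arcs show "e \<in> map_prod f f ` parcs H"
      by force
  qed
  then have "with_proj K = app_iso h (with_proj H)"
    by (simp add: app_iso_def with_proj_def h_def img)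
  ultimately show ?iso
    unfolding digraph_iso_def by blast
qed

lemma induced_subgraph_with_proj_iff:
  assumes G: "pair_wf_digraph G"
  shows "induced_subgraph (with_proj H) (with_proj G) \<longleftrightarrow>
    pverts H \<subseteq> pverts G \<and> parcs H = parcs G \<inter> pverts H \<times> pverts H"
proof -
  interpret G: pair_wf_digraph G by (rule G)
  have "wf_digraph (with_proj H)" if "parcs H = parcs G \<inter> pverts H \<times> pverts H"
    by (auto simp: wf_digraph_def that)
  then show ?thesis
    using G.wf_digraph_axioms by (auto simp: induced_subgraph_def subgraph_def compatible_def)
qed

text \<open>
  The copy is parametrised by an embedding of the pattern, so that for a concrete pattern the
  embedding is just a choice of vertices.
\<close>

lemma induced_copy_iff_embedding:
  assumes G: "pair_wf_digraph G" and K: "pair_wf_digraph K"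
  shows "(\<exists>H. induced_subgraph (with_proj H) (with_proj G) \<and>
              digraph_iso (with_proj H) (with_proj K)) \<longleftrightarrow>
    (\<exists>f. inj_on f (pverts K) \<and> f ` pverts K \<subseteq> pverts G \<and>
         (\<forall>u \<in> pverts K. \<forall>v \<in> pverts K. (u, v) \<in> parcs K \<longleftrightarrow> (f u, f v) \<in> parcs G))"
    (is "?copy \<longleftrightarrow> ?emb")
proof
  assume ?copy
  then obtain H where H: "induced_subgraph (with_proj H) (with_proj G)"
    and iso: "digraph_iso (with_proj H) (with_proj K)"
    by blast
  from H have sub: "pverts H \<subseteq> pverts G" and arcs_H: "parcs H = parcs G \<inter> pverts H \<times> pverts H"
    by (simp_all add: induced_subgraph_with_proj_iff[OF G])
  have wf_H: "pair_wf_digraph H"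
    by (auto simp: pair_wf_digraph_def arcs_H)
  have "wf_digraph (with_proj H)"
    using H by (auto simp: induced_subgraph_def subgraph_def)
  then have "digraph_iso (with_proj K) (with_proj H)"
    using iso by (rule digraph_iso_swap)
  then obtain f where bij: "bij_betw f (pverts K) (pverts H)"
    and arcs: "\<forall>u \<in> pverts K. \<forall>v \<in> pverts K. (u, v) \<in> parcs K \<longleftrightarrow> (f u, f v) \<in> parcs H"
    unfolding pair_digraph_iso_iff[OF K wf_H] by blast
  have "\<forall>u \<in> pverts K. \<forall>v \<in> pverts K. (u, v) \<in> parcs K \<longleftrightarrow> (f u, f v) \<in> parcs G"
    using arcs arcs_H bij by (auto dest: bij_betwE)
  moreover have "inj_on f (pverts K)" "f ` pverts K \<subseteq> pverts G"
    using bij sub by (auto simp: bij_betw_def)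
  ultimately show ?emb
    by blast
next
  interpret K: pair_wf_digraph K by (rule K)
  assume ?emb
  then obtain f where inj: "inj_on f (pverts K)" and sub: "f ` pverts K \<subseteq> pverts G"
    and arcs: "\<forall>u \<in> pverts K. \<forall>v \<in> pverts K. (u, v) \<in> parcs K \<longleftrightarrow> (f u, f v) \<in> parcs G"
    by blast
  define H where "H = \<lparr>pverts = f ` pverts K,
    parcs = parcs G \<inter> (f ` pverts K) \<times> (f ` pverts K)\<rparr>"
  have wf_H: "pair_wf_digraph H"
    by (auto simp: pair_wf_digraph_def H_def)
  have "induced_subgraph (with_proj H) (with_proj G)"
    using sub by (simp add: induced_subgraph_with_proj_iff[OF G] H_def)
  moreover have "digraph_iso (with_proj K) (with_proj H)"
    unfolding pair_digraph_iso_iff[OF K wf_H]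
    using inj arcs by (intro exI[of _ f]) (auto simp: bij_betw_def H_def)
  then have "digraph_iso (with_proj H) (with_proj K)"
    by (rule digraph_iso_swap[OF K.wf_digraph_axioms])
  ultimately show ?copy
    by blast
qed

text \<open>
  Symmetry and the absence of loops reduce the sixteen arc conditions on an embedding of the
  path to its three edges and three non-edges.
\<close>

lemma not_cograph_iff_induced_path:
  assumes "pair_graph G"
  shows "\<not> cograph G \<longleftrightarrow>
    (\<exists>a b c d. distinct [a, b, c, d] \<and> {a, b, c, d} \<subseteq> pverts G \<and>
       (a, b) \<in> parcs G \<and> (b, c) \<in> parcs G \<and> (c, d) \<in> parcs G \<and>
       (a, c) \<notin> parcs G \<and> (a, d) \<notin> parcs G \<and> (b, d) \<notin> parcs G)"
    (is "_ \<longleftrightarrow> ?path")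
proof -
  interpret G: pair_graph G by (rule assms)
  interpret P: pair_graph path_P4 by (rule pair_graph_path_P4)
  have symm: "(u, v) \<in> parcs G \<longleftrightarrow> (v, u) \<in> parcs G" for u v
    using G.pair_sym_arcs by (auto simp: symmetric_def dest: symD)
  have irrefl: "(u, u) \<notin> parcs G" for u
    using G.pair_no_loops by fastforce
  have verts_P4: "pverts path_P4 = {0, 1, 2, 3}"
    by (simp add: path_P4_def)
  have "\<not> cograph G \<longleftrightarrow>
    (\<exists>f. inj_on f {0, 1, 2, 3 :: nat} \<and> f ` {0, 1, 2, 3} \<subseteq> pverts G \<and>
       (\<forall>u \<in> {0, 1, 2, 3}. \<forall>v \<in> {0, 1, 2, 3}.
          (u, v) \<in> parcs path_P4 \<longleftrightarrow> (f u, f v) \<in> parcs G))" (is "_ \<longleftrightarrow> (\<exists>f. ?emb f)")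
    unfolding cograph_def not_not verts_P4[symmetric]
    by (rule induced_copy_iff_embedding[OF G.pair_wf_digraph_axioms P.pair_wf_digraph_axioms])
  also have "(\<exists>f. ?emb f) \<longleftrightarrow> ?path"
  proof
    assume "\<exists>f. ?emb f"
    then obtain f where f: "?emb f" ..
    then show ?path
      by (intro exI[of _ "f 0"] exI[of _ "f 1"] exI[of _ "f 2"] exI[of _ "f 3"])
        (simp add: path_P4_def)
  next
    assume ?path
    then obtain a b c d where path: "distinct [a, b, c, d]" "{a, b, c, d} \<subseteq> pverts G"
      "(a, b) \<in> parcs G" "(b, c) \<in> parcs G" "(c, d) \<in> parcs G"
      "(a, c) \<notin> parcs G" "(a, d) \<notin> parcs G" "(b, d) \<notin> parcs G"
      by blast
    moreover have "(b, a) \<in> parcs G" "(c, b) \<in> parcs G" "(d, c) \<in> parcs G"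
      "(c, a) \<notin> parcs G" "(d, a) \<notin> parcs G" "(d, b) \<notin> parcs G"
      using path symm[of a b] symm[of b c] symm[of c d] symm[of a c] symm[of a d] symm[of b d]
      by simp_all
    ultimately have "?emb (\<lambda>i. [a, b, c, d] ! i)"
      by (simp add: path_P4_def irrefl numeral_2_eq_2 numeral_3_eq_3)
    then show "\<exists>f. ?emb f"
      by (rule exI[of ?emb])
  qed
  finally show ?thesis .
qed

section \<open>Induced paths and element orders\<close>

lemma (in group) exists_ord_eq_divisor:
  assumes "finite (carrier G)" "x \<in> carrier G" "n dvd ord x"
  shows "\<exists>y \<in> carrier G. ord y = n"
proof -
  from assms(3) obtain k where k: "ord x = n * k" ..
  then have "k \<noteq> 0"
    using ord_ge_1[OF assms(1,2)] by (intro notI) simp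
  then have "ord (x [^] k) = n"
    using ord_pow[of x k] assms(2) k by simp
  then show ?thesis
    using assms(2) by blast
qed

lemma parcs_coprime_graph_iff:
  "(x, y) \<in> parcs (coprime_graph G) \<longleftrightarrow>
    x \<in> carrier G \<and> y \<in> carrier G \<and> x \<noteq> y \<and> coprime (group.ord G x) (group.ord G y)"
  by (simp add: coprime_graph_def coprime_iff_gcd_eq_1)

lemma common_prime_of_nonadjacent:
  assumes "x \<in> carrier G" "y \<in> carrier G" "x \<noteq> y" "(x, y) \<notin> parcs (coprime_graph G)"
  shows "\<exists>p. prime p \<and> p dvd group.ord G x \<and> p dvd group.ord G y"
proof -
  have "gcd (group.ord G x) (group.ord G y) \<noteq> 1"
    using assms by (simp add: coprime_graph_def)
  then show ?thesis
    by (meson gcd_nat.boundedE prime_factor_nat)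
qed

lemma prime_not_dvd_coprime:
  fixes p :: nat
  assumes "coprime m n" "prime p" "p dvd m"
  shows "\<not> p dvd n"
  using assms by (meson coprime_common_divisor not_prime_unit)

theorem theorem7:
  fixes G :: "('a, 'b) monoid_scheme"
  assumes "group G" and "finite (carrier G)"
  shows "cograph (coprime_graph G) \<longleftrightarrow>
    \<not> (\<exists>p1 p2 p3 :: nat. prime p1 \<and> prime p2 \<and> prime p3 \<and>
          p1 \<noteq> p2 \<and> p2 \<noteq> p3 \<and> p1 \<noteq> p3 \<and>
          (\<exists>g1 \<in> carrier G. \<exists>g2 \<in> carrier G.
             group.ord G g1 = p1 * p2 \<and> group.ord G g2 = p2 * p3))"
    (is "cograph ?\<Gamma> \<longleftrightarrow> \<not> ?primes")
proof -
  interpret group G by (rule assms(1))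
  note fin = assms(2)
  have verts: "pverts ?\<Gamma> = carrier G"
    by (simp add: coprime_graph_def)
  note path_iff = not_cograph_iff_induced_path[OF pair_graph_coprime_graph[OF fin], unfolded verts]
  have "\<not> cograph ?\<Gamma> \<longleftrightarrow> ?primes"
  proof
    assume "\<not> cograph ?\<Gamma>"
    then obtain a b c d where dist: "distinct [a, b, c, d]"
      and car: "{a, b, c, d} \<subseteq> carrier G"
      and edges: "(a, b) \<in> parcs ?\<Gamma>" "(b, c) \<in> parcs ?\<Gamma>" "(c, d) \<in> parcs ?\<Gamma>"
      and nonedges: "(a, c) \<notin> parcs ?\<Gamma>" "(a, d) \<notin> parcs ?\<Gamma>" "(b, d) \<notin> parcs ?\<Gamma>"
      unfolding path_iff by blast
    obtain p1 where p1: "prime p1" "p1 dvd ord a" "p1 dvd ord c"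
      using common_prime_of_nonadjacent[OF _ _ _ nonedges(1)] dist car by fastforce
    obtain p2 where p2: "prime p2" "p2 dvd ord a" "p2 dvd ord d"
      using common_prime_of_nonadjacent[OF _ _ _ nonedges(2)] dist car by fastforce
    obtain p3 where p3: "prime p3" "p3 dvd ord b" "p3 dvd ord d"
      using common_prime_of_nonadjacent[OF _ _ _ nonedges(3)] dist car by fastforce
    have ab: "coprime (ord a) (ord b)" and cd: "coprime (ord c) (ord d)"
      using edges by (simp_all add: parcs_coprime_graph_iff)
    \<comment> \<open>A coincidence \<open>p1 = p2\<close> would give \<open>c\<close> and \<open>d\<close> a common prime, and \<open>p2 = p3\<close> or
      \<open>p1 = p3\<close> would do the same for \<open>a\<close> and \<open>b\<close>.\<close>
    have ne: "p1 \<noteq> p2" "p2 \<noteq> p3" "p1 \<noteq> p3"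
      using p1 p2 p3 prime_not_dvd_coprime[OF ab] prime_not_dvd_coprime[OF cd] by auto
    have "p1 * p2 dvd ord a" "p2 * p3 dvd ord d"
      using p1 p2 p3 ne by (auto intro!: divides_mult primes_coprime)
    then have "\<exists>g1 \<in> carrier G. ord g1 = p1 * p2" "\<exists>g2 \<in> carrier G. ord g2 = p2 * p3"
      using exists_ord_eq_divisor[OF fin, of a] exists_ord_eq_divisor[OF fin, of d] car by simp_all
    then show ?primes
      using p1(1) p2(1) p3(1) ne by blast
  next
    assume ?primes
    then obtain p1 p2 p3 a d where prime: "prime p1" "prime p2" "prime p3"
      and ne: "p1 \<noteq> p2" "p2 \<noteq> p3" "p1 \<noteq> p3"
      and a: "a \<in> carrier G" "ord a = p1 * p2" and d: "d \<in> carrier G" "ord d = p2 * p3"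
      by blast
    obtain b where b: "b \<in> carrier G" "ord b = p3"
      using exists_ord_eq_divisor[OF fin d(1), of p3] d(2) by auto
    obtain c where c: "c \<in> carrier G" "ord c = p1"
      using exists_ord_eq_divisor[OF fin a(1), of p1] a(2) by auto
    have cop: "coprime p1 p2" "coprime p2 p3" "coprime p1 p3"
      "coprime p2 p1" "coprime p3 p2" "coprime p3 p1"
      using prime ne by (auto intro: primes_coprime)
    have gt: "p1 > 1" "p2 > 1" "p3 > 1"
      using prime prime_gt_1_nat by auto
    \<comment> \<open>The prime \<open>p3\<close> separates \<open>{a, c}\<close> from \<open>{b, d}\<close>.\<close>
    have "\<not> p3 dvd p1" "\<not> p3 dvd p2"
      using prime ne by (metis primes_dvd_imp_eq)+
    then have "\<not> p3 dvd ord a" "\<not> p3 dvd ord c" "p3 dvd ord b" "p3 dvd ord d"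
      using prime a b c d by (auto simp: prime_dvd_mult_iff)
    moreover have "ord a \<noteq> ord c" "ord b \<noteq> ord d"
      using a b c d gt by auto
    ultimately have "a \<noteq> b" "b \<noteq> c" "c \<noteq> d" "a \<noteq> c" "a \<noteq> d" "b \<noteq> d"
      by auto
    then have "distinct [a, b, c, d]"
      by auto
    then show "\<not> cograph ?\<Gamma>"
      unfolding path_iff using a b c d cop gt
      by (intro exI[of _ a] exI[of _ b] exI[of _ c] exI[of _ d])
        (auto simp: parcs_coprime_graph_iff coprime_commute)
  qed
  then show ?thesis
    by blast
qed

end
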